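(* Let $N\ge 1$, let $|v_{\rm target}\rangle$ be an $N$-qubit pure state (unit vector in $(\mathbb{C}^2)^{\otimes N}$), let $U$ be an $N$-qubit unitary (circuit), and set $S:=\mathcal{S}(U^\dagger|v_{\rm target}\rangle)$, where $\mathcal{S}(|\psi\rangle)=\sum_{i=1}^{N}\mathcal{S}_{\{i\}}(|\psi\rangle)$. Define $$f_1(S):=\frac12\Big(1-\sqrt{2^{1-S/N}-1}\Big),\qquad f_2(S):=\frac12\Big(1-\sqrt{2^{1-S+\lfloor S\rfloor}-1}+\lfloor S\rfloor\Big).$$ Then for every $N$-qubit product state $|\psi_{\rm product}\rangle$, $$1-\big|\langle v_{\rm target}|U|\psi_{\rm product}\rangle\big|^2\ \ge\ f_1(S).$$ Moreover, given the state $U^\dagger|v_{\rm target}\rangle$, one can construct an $N$-qubit product state $|\psi'_{\rm product}\rangle$ such that $$1-\big|\langle v_{\rm target}|U|\psi'_{\rm product}\rangle\big|^2\ \le\ f_2(S).$$ Furthermore, as $S\to 0$ (with $N$ fixed), $f_1(S)=\frac{\ln 2}{2N}S+O(S^3)$ and $f_2(S)=\frac{\ln 2}{2}S+O(S^3)$.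
   Context: For an $N$-qubit pure state $|\psi\rangle$ and $i\in\{1,\dots,N\}$, the reduced density matrix on qubit $i$ is $\rho_i=\mathrm{Tr}_{[N]\setminus\{i\}}[|\psi\rangle\langle\psi|]$, and the (single-qubit) Rényi-2 entanglement entropy is $\mathcal{S}_{\{i\}}(|\psi\rangle)=-\log_2\mathrm{Tr}[\rho_i^2]\in[0,1]$. A product state is a state of the form $|\phi_1\rangle\otimes\cdots\otimes|\phi_N\rangle$ with each $|\phi_n\rangle\in\mathbb{C}^2$ a unit vector. *)

theory Defs
  imports "HOL-Analysis.Analysis" "HOL-Library.Landau_Symbols"
begin

text \<open>
  The qubits are labelled by a finite type \<open>'n\<close>, so \<open>N = CARD('n) \<ge> 1\<close>.
  The space \<open>(\<complex>\<^sup>2)\<^sup>\<otimes>\<^sup>N\<close> is represented in its computational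
  basis, whose elements are the assignments \<open>'n \<Rightarrow> 2\<close> of a basis label of \<open>\<complex>\<^sup>2\<close>
  to each qubit. The norm of type \<open>complex ^ _\<close> is the Hilbert space norm.
\<close>

type_synonym qubit = "complex ^ 2"
type_synonym 'n qubits = "complex ^ ('n \<Rightarrow> 2)"

text \<open>The inner product of type \<open>complex ^ _\<close> in the library is only the real part of this one.\<close>

definition braket :: "complex ^ 'm \<Rightarrow> complex ^ 'm \<Rightarrow> complex" where
  "braket u w = (\<Sum>x\<in>UNIV. cnj (u $ x) * w $ x)"

definition ketbra :: "complex ^ 'm \<Rightarrow> complex ^ 'm \<Rightarrow> complex ^ 'm ^ 'm" where
  "ketbra u w = (\<chi> x y. u $ x * cnj (w $ y))"

definition dagger :: "complex ^ 'm ^ 'm \<Rightarrow> complex ^ 'm ^ 'm" where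
  "dagger A = (\<chi> x y. cnj (A $ y $ x))"

definition unitary :: "complex ^ 'm ^ 'm \<Rightarrow> bool" where
  "unitary U \<longleftrightarrow> dagger U ** U = mat 1 \<and> U ** dagger U = mat 1"

definition product_state :: "('n::finite) qubits \<Rightarrow> bool" where
  "product_state \<psi> \<longleftrightarrow>
     (\<exists>\<phi> :: 'n \<Rightarrow> qubit. (\<forall>n. norm (\<phi> n) = 1) \<and> \<psi> = (\<chi> x. \<Prod>n\<in>UNIV. \<phi> n $ x n))"

text \<open>Partial trace over all qubits except \<open>i\<close>; the index \<open>y\<close> of the sum runs over the basis
  labels of the qubits that are traced out.\<close>

definition partial_trace_except ::
    "'n \<Rightarrow> complex ^ (('n::finite) \<Rightarrow> 2) ^ ('n \<Rightarrow> 2) \<Rightarrow> complex ^ 2 ^ 2" where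
  "partial_trace_except i A =
     (\<chi> a b. \<Sum>y \<in> (UNIV - {i}) \<rightarrow>\<^sub>E UNIV. A $ (y(i := a)) $ (y(i := b)))"

definition reduced_density :: "('n::finite) qubits \<Rightarrow> 'n \<Rightarrow> complex ^ 2 ^ 2" where
  "reduced_density \<psi> i = partial_trace_except i (ketbra \<psi> \<psi>)"

text \<open>The trace is real because the reduced density matrix is Hermitian.\<close>

definition renyi2 :: "('n::finite) qubits \<Rightarrow> 'n \<Rightarrow> real" where
  "renyi2 \<psi> i = - log 2 (Re (trace (reduced_density \<psi> i ** reduced_density \<psi> i)))"

definition total_renyi2 :: "('n::finite) qubits \<Rightarrow> real" where
  "total_renyi2 \<psi> = (\<Sum>i\<in>UNIV. renyi2 \<psi> i)"

definition f1 :: "nat \<Rightarrow> real \<Rightarrow> real" where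
  "f1 N S = 1 / 2 * (1 - sqrt (2 powr (1 - S / real N) - 1))"

definition f2 :: "real \<Rightarrow> real" where
  "f2 S = 1 / 2 * (1 - sqrt (2 powr (1 - S + real_of_int \<lfloor>S\<rfloor>) - 1) + real_of_int \<lfloor>S\<rfloor>)"

end

theory Submission
  imports Defs "HOL-Real_Asymp.Real_Asymp"
begin

text \<open>
  Put \<open>u = U\<^sup>\<dagger> v\<close> and let \<open>P\<^sub>i\<close> be the projection onto the
  state \<open>\<phi>\<^sub>i\<close> of qubit \<open>i\<close>. Then \<open>\<parallel>P\<^sub>i u\<parallel>\<^sup>2 = \<langle>\<phi>\<^sub>i|\<rho>\<^sub>i|\<phi>\<^sub>i\<rangle>\<close>
  is at most the larger eigenvalue of \<open>\<rho>\<^sub>i\<close>, which is determined by the purity of \<open>\<rho>\<^sub>i\<close>.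
  The overlap of \<open>u\<close> with a product state is at most every \<open>\<parallel>P\<^sub>i u\<parallel>\<^sup>2\<close>; a qubit
  whose entropy is at least the average yields the lower bound. For the upper bound the top
  eigenvectors of the \<open>\<rho>\<^sub>i\<close> are taken. The projections commute, so the infidelity is at most
  the sum of the losses \<open>1 - \<parallel>P\<^sub>i u\<parallel>\<^sup>2\<close> (union bound). Each loss is a convex function of the
  entropy of its qubit, so at fixed total entropy their sum is largest when all entropies except
  one are \<open>0\<close> or \<open>1\<close>.
\<close>

section \<open>The Hermitian inner product\<close>

lemma braket_self: "braket u u = of_real ((norm u)\<^sup>2)"
  by (simp add: braket_def norm_vec_def L2_set_def sum_nonneg complex_norm_square mult.commute del: of_real_power)

lemma cnj_braket: "cnj (braket u w) = braket w u"
  by (simp add: braket_def mult.commute)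

lemma braket_diff_left: "braket (u - v) w = braket u w - braket v w"
  by (simp add: braket_def left_diff_distrib sum_subtractf)

lemma braket_diff_right: "braket u (v - w) = braket u v - braket u w"
  by (simp add: braket_def right_diff_distrib sum_subtractf)

lemma braket_scale_right: "braket u (c *s w) = c * braket u w"
  by (simp add: braket_def sum_distrib_left mult.left_commute)

lemma norm_braket_le: "cmod (braket u w) \<le> norm u * norm w"
proof -
  have "cmod (braket u w) \<le> (\<Sum>x\<in>UNIV. \<bar>norm (u $ x)\<bar> * \<bar>norm (w $ x)\<bar>)"
    unfolding braket_def by (rule order_trans[OF norm_sum]) (simp add: norm_mult)
  also have "\<dots> \<le> norm u * norm w"
    unfolding norm_vec_def by (rule L2_set_mult_ineq)
  finally show ?thesis .
qed

lemma braket_dagger: "braket (dagger A *v u) w = braket u (A *v w)"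
proof -
  have "braket (dagger A *v u) w = (\<Sum>x\<in>UNIV. \<Sum>y\<in>UNIV. A $ y $ x * cnj (u $ y) * w $ x)"
    by (simp add: braket_def dagger_def matrix_vector_mult_def sum_distrib_right)
  also have "\<dots> = (\<Sum>y\<in>UNIV. \<Sum>x\<in>UNIV. A $ y $ x * cnj (u $ y) * w $ x)"
    by (rule sum.swap)
  also have "\<dots> = braket u (A *v w)"
    by (simp add: braket_def matrix_vector_mult_def sum_distrib_left mult_ac)
  finally show ?thesis .
qed

lemma norm_unitary_dagger:
  assumes "unitary U"
  shows "norm (dagger U *v v) = norm v"
proof -
  have "braket (dagger U *v v) (dagger U *v v) = braket v v"
    using assms by (simp add: braket_dagger matrix_vector_mul_assoc unitary_def)
  then have "(norm (dagger U *v v))\<^sup>2 = (norm v)\<^sup>2"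
    by (simp only: braket_self of_real_eq_iff)
  then show ?thesis by simp
qed

section \<open>Projections onto a state of one qubit\<close>

text \<open>The operator |phi><phi| on qubit \<open>i\<close>, tensored with the identity on the
  others. Normalization is not built in: the idempotence lemma assumes
  \<open>norm \<phi> = 1\<close>.\<close>

definition qproj :: "('n::finite) \<Rightarrow> qubit \<Rightarrow> 'n qubits \<Rightarrow> 'n qubits" where
  "qproj i \<phi> u = (\<chi> x. \<phi> $ x i * (\<Sum>a\<in>UNIV. cnj (\<phi> $ a) * u $ (x(i := a))))"

lemma sum_split_qubit:
  fixes F :: "('n::finite \<Rightarrow> 2) \<Rightarrow> 'b::comm_monoid_add"
  shows "sum F UNIV = (\<Sum>y\<in>(UNIV - {i}) \<rightarrow>\<^sub>E UNIV. \<Sum>a\<in>UNIV. F (y(i := a)))"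
proof -
  \<comment> \<open>An extensional function on \<open>UNIV - {i}\<close> has the value
    \<open>undefined\<close> at \<open>i\<close>, so erasing coordinate \<open>i\<close> of
    \<open>x\<close> means \<open>x(i := undefined)\<close>.\<close>
  have "sum F UNIV = (\<Sum>(y, a)\<in>((UNIV - {i}) \<rightarrow>\<^sub>E UNIV) \<times> UNIV. F (y(i := a)))"
    by (rule sum.reindex_bij_witness
          [where i = "\<lambda>(y, a). y(i := a)" and j = "\<lambda>x. (x(i := undefined), x i)"])
       (auto simp: PiE_def extensional_def fun_eq_iff)
  then show ?thesis by (simp add: sum.cartesian_product)
qed

lemma qproj_diff: "qproj i \<phi> (u - v) = qproj i \<phi> u - qproj i \<phi> v"
  by (simp add: qproj_def vec_eq_iff right_diff_distrib sum_subtractf)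

text \<open>For each assignment \<open>y\<close> of the other qubits the sum factors into two
  one-qubit inner products. This form displays self-adjointness and has the same index set as the
  partial trace.\<close>

lemma braket_qproj:
  "braket u (qproj i \<phi> w) = (\<Sum>y\<in>(UNIV - {i}) \<rightarrow>\<^sub>E UNIV.
     (\<Sum>a\<in>UNIV. cnj (u $ (y(i := a))) * \<phi> $ a) * (\<Sum>a\<in>UNIV. cnj (\<phi> $ a) * w $ (y(i := a))))"
  unfolding braket_def qproj_def
  by (subst sum_split_qubit[where i = i]) (simp add: sum_distrib_right mult_ac)

lemma qproj_self_adjoint: "braket (qproj i \<phi> u) w = braket u (qproj i \<phi> w)"
proof -
  have "braket (qproj i \<phi> u) w = cnj (braket w (qproj i \<phi> u))"
    by (simp add: cnj_braket)
  also have "\<dots> = braket u (qproj i \<phi> w)"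
    unfolding braket_qproj by (simp add: mult_ac)
  finally show ?thesis .
qed

lemma qproj_idem:
  assumes "norm \<phi> = 1"
  shows "qproj i \<phi> (qproj i \<phi> u) = qproj i \<phi> u"
proof -
  have "(\<Sum>a\<in>UNIV. cnj (\<phi> $ a) * \<phi> $ a) = 1"
    using braket_self[of \<phi>] assms by (simp add: braket_def)
  moreover have "(\<Sum>a\<in>UNIV. cnj (\<phi> $ a) * (\<phi> $ a * z)) = (\<Sum>a\<in>UNIV. cnj (\<phi> $ a) * \<phi> $ a) * z" for z
    by (simp add: sum_distrib_left mult_ac)
  ultimately show ?thesis by (simp add: qproj_def vec_eq_iff)
qed

lemma qproj_commute:
  assumes "i \<noteq> j"
  shows "qproj i \<phi> (qproj j \<xi> u) = qproj j \<xi> (qproj i \<phi> u)"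
  unfolding vec_eq_iff
proof
  fix x
  show "qproj i \<phi> (qproj j \<xi> u) $ x = qproj j \<xi> (qproj i \<phi> u) $ x"
    using assms
    by (simp add: qproj_def sum_distrib_left)
      (subst sum.swap, simp add: mult_ac fun_upd_twist[OF assms])
qed

text \<open>The cross terms vanish because the projection is self-adjoint and idempotent.\<close>

lemma norm_qproj_Pythagoras:
  assumes "norm \<phi> = 1"
  shows "(norm u)\<^sup>2 = (norm (qproj i \<phi> u))\<^sup>2 + (norm (u - qproj i \<phi> u))\<^sup>2"
proof -
  have "braket u u = braket (qproj i \<phi> u) (qproj i \<phi> u) + braket (u - qproj i \<phi> u) (u - qproj i \<phi> u)"
    by (simp add: braket_diff_left braket_diff_right qproj_self_adjoint qproj_idem[OF assms])
  then show ?thesis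
    unfolding braket_self of_real_add[symmetric] of_real_eq_iff .
qed

lemma norm_qproj_le:
  assumes "norm \<phi> = 1"
  shows "norm (qproj i \<phi> u) \<le> norm u"
proof (rule power2_le_imp_le)
  show "(norm (qproj i \<phi> u))\<^sup>2 \<le> (norm u)\<^sup>2"
    unfolding norm_qproj_Pythagoras[OF assms, of u i] by simp
qed simp

section \<open>Overlap with product states\<close>

text \<open>Only factor \<open>i\<close> of the product depends on coordinate \<open>i\<close>, so
  the inner sum pulls out <phi_i|phi_i> = 1.\<close>

lemma qproj_product:
  assumes "norm (\<phi> i) = 1"
  shows "qproj i (\<phi> i) (\<chi> x. \<Prod>n\<in>UNIV. \<phi> n $ x n) = (\<chi> x. \<Prod>n\<in>UNIV. \<phi> n $ x n)"
proof -
  have s: "(\<Sum>a\<in>UNIV. cnj (\<phi> i $ a) * \<phi> i $ a) = 1"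
    using braket_self[of "\<phi> i"] assms by (simp add: braket_def)
  have split: "(\<Prod>n\<in>UNIV. \<phi> n $ x n) = \<phi> i $ x i * (\<Prod>n\<in>UNIV - {i}. \<phi> n $ x n)" for x
    by (rule prod.remove) auto
  have "(\<Prod>n\<in>UNIV - {i}. \<phi> n $ (x(i := a)) n) = (\<Prod>n\<in>UNIV - {i}. \<phi> n $ x n)" for x a
    by (rule prod.cong) auto
  then have "(\<Sum>a\<in>UNIV. cnj (\<phi> i $ a) * (\<Prod>n\<in>UNIV. \<phi> n $ (x(i := a)) n)) =
      (\<Sum>a\<in>UNIV. cnj (\<phi> i $ a) * \<phi> i $ a) * (\<Prod>n\<in>UNIV - {i}. \<phi> n $ x n)" for x
    unfolding split by (simp add: sum_distrib_left mult_ac)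
  then show ?thesis
    unfolding qproj_def vec_eq_iff by (simp only: vec_lambda_beta s split) simp
qed

lemma norm_product:
  fixes \<phi> :: "'n::finite \<Rightarrow> qubit"
  assumes "\<And>n. norm (\<phi> n) = 1"
  shows "norm (\<chi> x. \<Prod>n\<in>UNIV. \<phi> n $ x n) = 1"
proof -
  have "(norm (\<chi> x. \<Prod>n\<in>UNIV. \<phi> n $ x n))\<^sup>2 = (\<Sum>x\<in>UNIV. \<Prod>n\<in>UNIV. (norm (\<phi> n $ x n))\<^sup>2)"
    by (simp add: norm_vec_def L2_set_def sum_nonneg prod_nonneg prod_norm[symmetric] prod_power_distrib)
  also have "\<dots> = (\<Prod>n\<in>UNIV. \<Sum>a\<in>UNIV. (norm (\<phi> n $ a))\<^sup>2)"
    by (subst prod_sum_PiE) (simp_all add: PiE_def)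
  also have "\<dots> = (\<Prod>n\<in>UNIV. (norm (\<phi> n))\<^sup>2)"
    by (simp add: norm_vec_def L2_set_def sum_nonneg)
  also have "\<dots> = 1" using assms by simp
  finally show ?thesis by (intro power2_eq_imp_eq[where y = 1]) auto
qed

text \<open>The projection fixes the product state, so it can be moved onto \<open>u\<close>;
  Cauchy-Schwarz finishes.\<close>

lemma overlap_product_le:
  fixes \<phi> :: "'n::finite \<Rightarrow> qubit"
  assumes "\<And>n. norm (\<phi> n) = 1"
  shows "(cmod (braket u (\<chi> x. \<Prod>n\<in>UNIV. \<phi> n $ x n)))\<^sup>2 \<le> (norm (qproj i (\<phi> i) u))\<^sup>2"
proof -
  have "braket u (\<chi> x. \<Prod>n\<in>UNIV. \<phi> n $ x n) = braket (qproj i (\<phi> i) u) (\<chi> x. \<Prod>n\<in>UNIV. \<phi> n $ x n)"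
    by (simp add: qproj_self_adjoint qproj_product assms)
  also have "cmod \<dots> \<le> norm (qproj i (\<phi> i) u) * 1"
    using norm_braket_le[of "qproj i (\<phi> i) u" "\<chi> x. \<Prod>n\<in>UNIV. \<phi> n $ x n"]
    by (simp add: norm_product[OF assms])
  finally show ?thesis by (simp add: power_mono)
qed

text \<open>A list fixes the order of composition. Commutation is available only for different
  qubits, hence the later conditions \<open>distinct ns\<close> and
  \<open>i \<notin> set ns\<close>.\<close>

abbreviation qprojs :: "('n::finite \<Rightarrow> qubit) \<Rightarrow> 'n list \<Rightarrow> 'n qubits \<Rightarrow> 'n qubits" where
  "qprojs \<phi> ns \<equiv> foldr (\<lambda>i. qproj i (\<phi> i)) ns"

lemma qprojs_diff: "qprojs \<phi> ns (u - v) = qprojs \<phi> ns u - qprojs \<phi> ns v"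
  by (induction ns) (simp_all add: qproj_diff)

lemma qprojs_commute:
  "i \<notin> set ns \<Longrightarrow> qproj i \<xi> (qprojs \<phi> ns u) = qprojs \<phi> ns (qproj i \<xi> u)"
proof (induction ns)
  case (Cons j ns)
  then show ?case using qproj_commute[of i j \<xi> "\<phi> j" "qprojs \<phi> ns u"] by simp
qed simp

lemma norm_qprojs_le:
  assumes "\<And>n. norm (\<phi> n) = 1"
  shows "norm (qprojs \<phi> ns u) \<le> norm u"
proof (induction ns)
  case (Cons i ns)
  then show ?case using norm_qproj_le[OF assms[of i], of i "qprojs \<phi> ns u"] by simp
qed simp

text \<open>One further projection costs the squared norm of the rejected part of
  \<open>?q u\<close>. By commutation this is \<open>?q\<close> applied to the rejected part of
  \<open>u\<close>, and \<open>?q\<close> is a contraction.\<close>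

lemma qprojs_union_bound:
  assumes "\<And>n. norm (\<phi> n) = 1" "distinct ns"
  shows "(norm u)\<^sup>2 - (norm (qprojs \<phi> ns u))\<^sup>2 \<le> (\<Sum>i\<in>set ns. (norm u)\<^sup>2 - (norm (qproj i (\<phi> i) u))\<^sup>2)"
  using assms(2)
proof (induction ns)
  case (Cons i ns)
  let ?q = "qprojs \<phi> ns"
  have "(norm (?q u))\<^sup>2 - (norm (qproj i (\<phi> i) (?q u)))\<^sup>2 = (norm (?q (u - qproj i (\<phi> i) u)))\<^sup>2"
    using norm_qproj_Pythagoras[OF assms(1)[of i], of "?q u" i] Cons.prems
    by (simp add: qprojs_diff qprojs_commute)
  also have "\<dots> \<le> (norm (u - qproj i (\<phi> i) u))\<^sup>2"
    by (intro power_mono norm_qprojs_le assms(1)) auto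
  also have "\<dots> = (norm u)\<^sup>2 - (norm (qproj i (\<phi> i) u))\<^sup>2"
    using norm_qproj_Pythagoras[OF assms(1)[of i], of u i] by simp
  finally show ?case using Cons by simp
qed simp

text \<open>On the listed qubits the result is already a product; the cofactor \<open>g\<close> sees
  only the unlisted ones, so it is constant once all qubits are listed.\<close>

lemma qprojs_factor:
  assumes "distinct ns"
  shows "\<exists>g. (\<forall>x. qprojs \<phi> ns u $ x = (\<Prod>n\<in>set ns. \<phi> n $ x n) * g x) \<and>
    (\<forall>x y. (\<forall>n. n \<notin> set ns \<longrightarrow> x n = y n) \<longrightarrow> g x = g y)"
  using assms
proof (induction ns)
  case Nil
  show ?case by (intro exI[of _ "\<lambda>x. u $ x"]) (simp add: fun_eq_iff[symmetric])
next
  case (Cons i ns)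
  then have "distinct ns" by simp
  from Cons.IH[OF this] obtain g where g: "\<forall>x. qprojs \<phi> ns u $ x = (\<Prod>n\<in>set ns. \<phi> n $ x n) * g x"
    and g': "\<forall>x y. (\<forall>n. n \<notin> set ns \<longrightarrow> x n = y n) \<longrightarrow> g x = g y"
    by blast
  define h where "h x = (\<Sum>a\<in>UNIV. cnj (\<phi> i $ a) * g (x(i := a)))" for x
  have i: "i \<notin> set ns" using Cons.prems by simp
  have "(\<Prod>n\<in>set ns. \<phi> n $ (x(i := a)) n) = (\<Prod>n\<in>set ns. \<phi> n $ x n)" for x a
    using i by (intro prod.cong) auto
  then have "qprojs \<phi> (i # ns) u $ x = (\<Prod>n\<in>set (i # ns). \<phi> n $ x n) * h x" for x
    using i by (simp add: qproj_def g h_def sum_distrib_left mult_ac)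
  moreover have "h x = h y" if "\<And>n. n \<notin> set (i # ns) \<Longrightarrow> x n = y n" for x y
    unfolding h_def using that by (intro sum.cong refl arg_cong2[where f = "(*)"] g'[rule_format]) auto
  ultimately show ?case by blast
qed

text \<open>Projecting every qubit amounts to the rank-one projection onto the product state
  \<open>p\<close>: the result is \<open>c *s p\<close> with \<open>c = braket p u\<close>.\<close>

lemma norm_qprojs_UNIV:
  fixes \<phi> :: "'n::finite \<Rightarrow> qubit"
  assumes "\<And>n. norm (\<phi> n) = 1" "distinct ns" "set ns = UNIV"
  shows "norm (qprojs \<phi> ns u) = cmod (braket u (\<chi> x. \<Prod>n\<in>UNIV. \<phi> n $ x n))"
proof -
  define p where "p = (\<chi> x. \<Prod>n\<in>UNIV. \<phi> n $ x n)"
  obtain g where g: "\<And>x. qprojs \<phi> ns u $ x = (\<Prod>n\<in>UNIV. \<phi> n $ x n) * g x"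
    and g': "\<And>x y. g x = g y"
    using qprojs_factor[OF assms(2), of \<phi> u] assms(3) by auto
  \<comment> \<open>The cofactor is constant, so its value at any assignment serves.\<close>
  define c where "c = g undefined"
  have q: "qprojs \<phi> ns u = c *s p"
    unfolding vec_eq_iff p_def c_def using g g'[of _ undefined] by simp
  have np: "norm p = 1" unfolding p_def by (rule norm_product[OF assms(1)])
  have inv: "braket p (qprojs \<phi> ms w) = braket p w" for ms w
    by (induction ms)
      (simp_all add: qproj_self_adjoint[symmetric] qproj_product assms(1) p_def)
  have pc: "braket p u = c"
    using inv[of ns u] by (simp add: q braket_scale_right braket_self np)
  have "(norm (c *s p))\<^sup>2 = (cmod c)\<^sup>2 * (norm p)\<^sup>2"
    by (simp add: norm_vec_def L2_set_def sum_nonneg norm_mult power_mult_distrib sum_distrib_left)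
  then have "norm (c *s p) = cmod c"
    by (simp add: np)
  also have "\<dots> = cmod (braket u p)"
    by (simp flip: pc cnj_braket[of u p])
  finally show ?thesis by (simp add: q p_def)
qed

lemma overlap_product_ge:
  fixes \<phi> :: "'n::finite \<Rightarrow> qubit"
  assumes "\<And>n. norm (\<phi> n) = 1" "norm u = 1"
  shows "1 - (cmod (braket u (\<chi> x. \<Prod>n\<in>UNIV. \<phi> n $ x n)))\<^sup>2
    \<le> (\<Sum>i\<in>UNIV. 1 - (norm (qproj i (\<phi> i) u))\<^sup>2)"
proof -
  obtain ns where "set ns = (UNIV :: 'n set)" "distinct ns"
    using finite_distinct_list[of "UNIV :: 'n set"] by auto
  then show ?thesis
    using qprojs_union_bound[of \<phi> ns u] norm_qprojs_UNIV[of \<phi> ns u] assms by simp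
qed

section \<open>The reduced density matrix\<close>

definition purity :: "('n::finite) qubits \<Rightarrow> 'n \<Rightarrow> real" where
  "purity \<psi> i = Re (trace (reduced_density \<psi> i ** reduced_density \<psi> i))"

lemma norm_qproj_reduced_density:
  "of_real ((norm (qproj i \<phi> \<psi>))\<^sup>2) =
    (\<Sum>a\<in>UNIV. \<Sum>b\<in>UNIV. cnj (\<phi> $ a) * reduced_density \<psi> i $ a $ b * \<phi> $ b)"
  if "norm \<phi> = 1"
proof -
  have "of_real ((norm (qproj i \<phi> \<psi>))\<^sup>2) = braket \<psi> (qproj i \<phi> \<psi>)"
    unfolding braket_self[symmetric] by (simp add: qproj_self_adjoint qproj_idem that)
  also have "\<dots> = (\<Sum>a\<in>UNIV. \<Sum>b\<in>UNIV. cnj (\<phi> $ a) * reduced_density \<psi> i $ a $ b * \<phi> $ b)"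
    unfolding braket_qproj reduced_density_def partial_trace_except_def ketbra_def
    by (simp add: UNIV_2 algebra_simps sum.distrib sum_distrib_left)
  finally show ?thesis .
qed

text \<open>Hermitian with trace one. The last equation says that
  \<open>2 * purity \<psi> i - 1\<close> is the squared length of the Bloch vector, whose components
  are \<open>2 * p - 1\<close> and, up to sign, twice the real and imaginary parts of
  \<open>z\<close>.\<close>

lemma reduced_density_entries:
  assumes "norm \<psi> = 1"
  obtains p z where "reduced_density \<psi> i $ 1 $ 1 = of_real p"
    "reduced_density \<psi> i $ 2 $ 2 = of_real (1 - p)"
    "reduced_density \<psi> i $ 1 $ 2 = z" "reduced_density \<psi> i $ 2 $ 1 = cnj z"
    "2 * purity \<psi> i - 1 = (2 * p - 1)\<^sup>2 + (2 * cmod z)\<^sup>2"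
proof -
  let ?r = "reduced_density \<psi> i"
  define w where "w a = (\<Sum>y\<in>(UNIV - {i}) \<rightarrow>\<^sub>E UNIV. (cmod (\<psi> $ (y(i := a))))\<^sup>2)" for a
  have d: "?r $ a $ a = of_real (w a)" for a
    by (simp add: w_def reduced_density_def partial_trace_except_def ketbra_def complex_norm_square
        del: of_real_power)
  have "(norm \<psi>)\<^sup>2 = w 1 + w 2"
    unfolding norm_vec_def L2_set_def w_def
    by (simp add: sum_nonneg sum_split_qubit[where i = i] UNIV_2 sum.distrib)
  then have w2: "w 2 = 1 - w 1" using assms by simp
  have h: "?r $ 2 $ 1 = cnj (?r $ 1 $ 2)"
    by (simp add: reduced_density_def partial_trace_except_def ketbra_def mult.commute)
  have "trace (?r ** ?r) = of_real ((w 1)\<^sup>2 + (1 - w 1)\<^sup>2) + 2 * (?r $ 1 $ 2 * cnj (?r $ 1 $ 2))"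
    by (simp add: trace_def matrix_matrix_mult_def UNIV_2 d h w2 power2_eq_square)
  also have "\<dots> = of_real ((w 1)\<^sup>2 + (1 - w 1)\<^sup>2 + 2 * (cmod (?r $ 1 $ 2))\<^sup>2)"
    unfolding complex_norm_square[symmetric] by simp
  finally have "trace (?r ** ?r) = of_real ((w 1)\<^sup>2 + (1 - w 1)\<^sup>2 + 2 * (cmod (?r $ 1 $ 2))\<^sup>2)" .
  then have "purity \<psi> i = (w 1)\<^sup>2 + (1 - w 1)\<^sup>2 + 2 * (cmod (?r $ 1 $ 2))\<^sup>2"
    by (simp only: purity_def Re_complex_of_real)
  then have "2 * purity \<psi> i - 1 = (2 * w 1 - 1)\<^sup>2 + (2 * cmod (?r $ 1 $ 2))\<^sup>2"
    by (simp add: power2_eq_square algebra_simps)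
  then show ?thesis using that d h w2 by metis
qed

lemma qproj_norm_eq:
  assumes "norm \<phi> = 1"
    "reduced_density \<psi> i $ 1 $ 1 = of_real p" "reduced_density \<psi> i $ 2 $ 2 = of_real (1 - p)"
    "reduced_density \<psi> i $ 1 $ 2 = z" "reduced_density \<psi> i $ 2 $ 1 = cnj z"
  shows "(norm (qproj i \<phi> \<psi>))\<^sup>2 = p * (cmod (\<phi> $ 1))\<^sup>2 + (1 - p) * (cmod (\<phi> $ 2))\<^sup>2
     + 2 * Re (cnj (\<phi> $ 1) * z * \<phi> $ 2)"
proof -
  have "(norm (qproj i \<phi> \<psi>))\<^sup>2 = Re (of_real ((norm (qproj i \<phi> \<psi>))\<^sup>2))" by simp
  also have "\<dots> = p * (cmod (\<phi> $ 1))\<^sup>2 + (1 - p) * (cmod (\<phi> $ 2))\<^sup>2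
     + 2 * Re (cnj (\<phi> $ 1) * z * \<phi> $ 2)"
    unfolding norm_qproj_reduced_density[OF assms(1)]
    by (simp add: UNIV_2 assms(2-) cmod_power2) (simp add: power2_eq_square algebra_simps)
  finally show ?thesis .
qed

text \<open>Once the phase of \<open>z\<close> is bounded away, the quadratic form is (1 + a dot
  product)/2 of a vector of Bloch length with the unit vector
  \<open>(s^2 - t^2, 2 * s * t)\<close>.\<close>

lemma qproj_le_purity:
  assumes "norm \<psi> = 1" "norm \<phi> = 1"
  shows "(norm (qproj i \<phi> \<psi>))\<^sup>2 \<le> (1 + sqrt (2 * purity \<psi> i - 1)) / 2"
proof -
  obtain p z where r: "reduced_density \<psi> i $ 1 $ 1 = of_real p"
    "reduced_density \<psi> i $ 2 $ 2 = of_real (1 - p)"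
    "reduced_density \<psi> i $ 1 $ 2 = z" "reduced_density \<psi> i $ 2 $ 1 = cnj z"
    and P: "2 * purity \<psi> i - 1 = (2 * p - 1)\<^sup>2 + (2 * cmod z)\<^sup>2"
    using reduced_density_entries[OF assms(1)] by metis
  define s t where "s = cmod (\<phi> $ 1)" and "t = cmod (\<phi> $ 2)"
  have st: "s\<^sup>2 + t\<^sup>2 = 1"
    using assms(2) by (simp add: norm_vec_def L2_set_def UNIV_2 s_def t_def)
  have "Re (cnj (\<phi> $ 1) * z * \<phi> $ 2) \<le> s * cmod z * t"
    using complex_Re_le_cmod[of "cnj (\<phi> $ 1) * z * \<phi> $ 2"] by (simp add: norm_mult s_def t_def)
  moreover have "p * s\<^sup>2 + (1 - p) * t\<^sup>2 = 1 / 2 + (2 * p - 1) * (s\<^sup>2 - t\<^sup>2) / 2"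
    using st by algebra
  ultimately have "(norm (qproj i \<phi> \<psi>))\<^sup>2 \<le> (1 + ((2 * p - 1) * (s\<^sup>2 - t\<^sup>2) + 2 * cmod z * (2 * s * t))) / 2"
    unfolding qproj_norm_eq[OF assms(2) r] by (simp add: s_def t_def field_simps)
  also have "(2 * p - 1) * (s\<^sup>2 - t\<^sup>2) + 2 * cmod z * (2 * s * t) \<le> sqrt (2 * purity \<psi> i - 1)"
  proof (rule real_le_rsqrt)
    have "(s\<^sup>2 - t\<^sup>2)\<^sup>2 + (2 * s * t)\<^sup>2 = (s\<^sup>2 + t\<^sup>2)\<^sup>2" by algebra
    then have "((2 * p - 1)\<^sup>2 + (2 * cmod z)\<^sup>2) * ((s\<^sup>2 - t\<^sup>2)\<^sup>2 + (2 * s * t)\<^sup>2)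
        = (2 * p - 1)\<^sup>2 + (2 * cmod z)\<^sup>2"
      by (simp add: st)
    \<comment> \<open>Lagrange's identity, which yields Cauchy-Schwarz in the plane.\<close>
    moreover have "(a * c + b * d)\<^sup>2 + (a * d - b * c)\<^sup>2 = (a\<^sup>2 + b\<^sup>2) * (c\<^sup>2 + d\<^sup>2)"
      for a b c d :: real by algebra
    ultimately show "((2 * p - 1) * (s\<^sup>2 - t\<^sup>2) + 2 * cmod z * (2 * s * t))\<^sup>2 \<le> 2 * purity \<psi> i - 1"
      unfolding P by (metis le_add_same_cancel1 zero_le_power2)
  qed
  finally show ?thesis by simp
qed

lemma qproj_purity_attained:
  assumes "norm \<psi> = 1"
  obtains \<phi> where "norm \<phi> = 1" "(norm (qproj i \<phi> \<psi>))\<^sup>2 = (1 + sqrt (2 * purity \<psi> i - 1)) / 2"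
proof -
  obtain p z where r: "reduced_density \<psi> i $ 1 $ 1 = of_real p"
    "reduced_density \<psi> i $ 2 $ 2 = of_real (1 - p)"
    "reduced_density \<psi> i $ 1 $ 2 = z" "reduced_density \<psi> i $ 2 $ 1 = cnj z"
    and P: "2 * purity \<psi> i - 1 = (2 * p - 1)\<^sup>2 + (2 * cmod z)\<^sup>2"
    using reduced_density_entries[OF assms(1)] by metis
  define R where "R = sqrt (2 * purity \<psi> i - 1)"
  have R2: "R\<^sup>2 = (2 * p - 1)\<^sup>2 + (2 * cmod z)\<^sup>2" and R0: "R \<ge> 0"
    by (auto simp: R_def P)
  \<comment> \<open>The cosine of the polar angle of the Bloch vector. If \<open>R = 0\<close>, then
    \<open>2 * p - 1\<close> and \<open>z\<close> vanish and any value in [-1, 1] would do.\<close>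
  define c where "c = (if R = 0 then 1 else (2 * p - 1) / R)"
  \<comment> \<open>The relative phase that makes the off-diagonal term real and nonnegative;
    arbitrary of modulus one when \<open>z = 0\<close>.\<close>
  define e where "e = (if z = 0 then 1 else cnj z / of_real (cmod z))"
  have cR: "c * R = 2 * p - 1"
    using R2 sum_power2_eq_zero_iff[of "2 * p - 1" "2 * cmod z"] by (auto simp: c_def)
  have cR2: "c\<^sup>2 * R\<^sup>2 = (2 * p - 1)\<^sup>2"
    unfolding cR[symmetric] by (rule power_mult_distrib[symmetric])
  then have "c\<^sup>2 * R\<^sup>2 \<le> 1 * R\<^sup>2"
    by (simp add: R2)
  then have "c\<^sup>2 \<le> 1"
    by (cases "R = 0") (auto simp: c_def dest: mult_right_le_imp_le)
  then have c: "\<bar>c\<bar> \<le> 1" by (simp add: abs_square_le_1)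
  have "(sqrt (1 - c\<^sup>2) * R)\<^sup>2 = R\<^sup>2 - c\<^sup>2 * R\<^sup>2"
    using \<open>c\<^sup>2 \<le> 1\<close> by (simp add: power_mult_distrib left_diff_distrib)
  then have "(sqrt (1 - c\<^sup>2) * R)\<^sup>2 = (2 * cmod z)\<^sup>2"
    using cR2 R2 by linarith
  then have sR: "sqrt (1 - c\<^sup>2) * R = 2 * cmod z"
    by (rule power2_eq_imp_eq) (use \<open>c\<^sup>2 \<le> 1\<close> R0 in simp_all)
  have e: "cmod e = 1" "z * e = of_real (cmod z)"
    by (auto simp: e_def norm_divide complex_norm_square[symmetric] power2_eq_square)
  \<comment> \<open>The Bloch vector of \<open>\<phi>\<close> is the normalized Bloch vector of the reduced density matrix.\<close>
  define \<phi> :: qubit where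
    "\<phi> = (\<chi> a. if a = 1 then of_real (sqrt ((1 + c) / 2)) else of_real (sqrt ((1 - c) / 2)) * e)"
  have phi: "\<phi> $ 1 = of_real (sqrt ((1 + c) / 2))" "\<phi> $ 2 = of_real (sqrt ((1 - c) / 2)) * e"
    by (simp_all add: \<phi>_def)
  have m: "(cmod (\<phi> $ 1))\<^sup>2 = (1 + c) / 2" "(cmod (\<phi> $ 2))\<^sup>2 = (1 - c) / 2"
    using c by (simp_all add: phi norm_mult e)
  have n: "norm \<phi> = 1"
    by (simp add: norm_vec_def L2_set_def UNIV_2 m add_divide_distrib[symmetric])
  have "cnj (\<phi> $ 1) * z * \<phi> $ 2 = of_real (sqrt ((1 + c) / 2) * sqrt ((1 - c) / 2)) * (z * e)"
    by (simp add: phi)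
  also have "sqrt ((1 + c) / 2) * sqrt ((1 - c) / 2) = sqrt ((1 - c\<^sup>2) / 2\<^sup>2)"
    by (simp add: real_sqrt_mult[symmetric] power2_eq_square algebra_simps)
  also have "\<dots> = sqrt (1 - c\<^sup>2) / 2"
    by (simp add: real_sqrt_divide)
  finally have "cnj (\<phi> $ 1) * z * \<phi> $ 2 = of_real (sqrt (1 - c\<^sup>2) / 2 * cmod z)"
    by (simp only: e of_real_mult)
  then have "Re (cnj (\<phi> $ 1) * z * \<phi> $ 2) = sqrt (1 - c\<^sup>2) / 2 * cmod z"
    by (simp only: Re_complex_of_real)
  then have "(norm (qproj i \<phi> \<psi>))\<^sup>2 = (1 + c * (2 * p - 1) + sqrt (1 - c\<^sup>2) * (2 * cmod z)) / 2"
    unfolding qproj_norm_eq[OF n r] m by (simp add: field_simps)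
  also have "\<dots> = (1 + (c\<^sup>2 + (sqrt (1 - c\<^sup>2))\<^sup>2) * R) / 2"
    unfolding cR[symmetric] sR[symmetric] by (simp add: power2_eq_square algebra_simps)
  also have "\<dots> = (1 + R) / 2"
    using \<open>c\<^sup>2 \<le> 1\<close> by simp
  finally show ?thesis using that n R_def by blast
qed

text \<open>Below, a sum of squares is nonnegative. Above, the attained value
  \<open>(1 + R) / 2\<close> is the squared norm of a projected unit vector, hence at most
  1.\<close>

lemma purity_bounds:
  assumes "norm \<psi> = 1"
  shows "1 / 2 \<le> purity \<psi> i" "purity \<psi> i \<le> 1"
proof -
  obtain p z where "2 * purity \<psi> i - 1 = (2 * p - 1)\<^sup>2 + (2 * cmod z)\<^sup>2"
    using reduced_density_entries[OF assms(1)] by metis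
  then have "0 \<le> 2 * purity \<psi> i - 1" by simp
  then show "1 / 2 \<le> purity \<psi> i" by simp
  define R where "R = sqrt (2 * purity \<psi> i - 1)"
  obtain \<phi> where "norm \<phi> = 1" "(norm (qproj i \<phi> \<psi>))\<^sup>2 = (1 + R) / 2"
    using qproj_purity_attained[OF assms] unfolding R_def by metis
  moreover from this have "(norm (qproj i \<phi> \<psi>))\<^sup>2 \<le> 1"
    using norm_qproj_le[of \<phi> i \<psi>] assms by (simp add: power_le_one)
  ultimately have "R \<le> 1" by simp
  then show "purity \<psi> i \<le> 1" by (simp add: R_def)
qed

lemma renyi2_bounds:
  assumes "norm \<psi> = 1"
  shows "0 \<le> renyi2 \<psi> i" "renyi2 \<psi> i \<le> 1"
proof -
  note b = purity_bounds[OF assms, of i]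
  have r: "renyi2 \<psi> i = - log 2 (purity \<psi> i)" by (simp add: renyi2_def purity_def)
  show "0 \<le> renyi2 \<psi> i" using b by (simp add: r)
  have "log 2 (1 / 2) \<le> log 2 (purity \<psi> i)" using b by (subst log_le_cancel_iff) auto
  then show "renyi2 \<psi> i \<le> 1" by (simp add: r log_divide)
qed

text \<open>Identifies the radicand in \<open>infid\<close> with the squared Bloch length.\<close>

lemma purity_renyi2:
  assumes "norm \<psi> = 1"
  shows "2 powr (1 - renyi2 \<psi> i) = 2 * purity \<psi> i"
proof -
  have "purity \<psi> i > 0" using purity_bounds[OF assms, of i] by linarith
  then show ?thesis
    by (simp add: renyi2_def purity_def[symmetric] powr_add)
qed

section \<open>The infidelity of a single qubit\<close>

text \<open>\<open>infid s\<close> is the smaller eigenvalue of a qubit density matrix of Renyi-2 entropy \<open>s\<close>.\<close>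

definition infid :: "real \<Rightarrow> real" where
  "infid s = (1 - sqrt (2 powr (1 - s) - 1)) / 2"

lemma infid_mono: "s \<le> t \<Longrightarrow> infid s \<le> infid t"
  by (simp add: infid_def)

lemma infid_0: "infid 0 = 0" and infid_1: "infid 1 = 1 / 2"
  by (simp_all add: infid_def)

text \<open>After squaring, the claim is \<open>t + v \<le> s + u\<close>, where \<open>u\<^sup>2 - v\<^sup>2 = 2 (t - s)\<close>
  and \<open>u + v \<le> 2\<close>.\<close>

lemma sqrt_sum_le_of_prod_eq:
  fixes a b c d :: real
  assumes "a * b = c * d" "a \<le> c" "b \<le> c" "d \<ge> 1 / 2" "a \<ge> 1/2" "b \<ge> 1/2" "a \<le> 1" "b \<le> 1"
  shows "sqrt (2 * c - 1) + sqrt (2 * d - 1) \<le> sqrt (2 * a - 1) + sqrt (2 * b - 1)"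
proof -
  define s t where "s = a + b" and "t = c + d"
  have c: "c \<ge> 1 / 2" using assms by simp
  \<comment> \<open>At fixed product the sum grows as the factors spread apart; \<open>c\<close> is
    at least as large as \<open>a\<close> and \<open>b\<close>.\<close>
  have "0 \<le> (c - a) * (c - b)" using assms by simp
  also have "\<dots> = c * (t - s)" using assms(1) by (simp add: s_def t_def algebra_simps)
  finally have st: "s \<le> t" using c by (simp add: zero_le_mult_iff)
  define u v where "u = sqrt ((2 * a - 1) * (2 * b - 1))" and "v = sqrt ((2 * c - 1) * (2 * d - 1))"
  have "(2 * a - 1) * (2 * b - 1) - (2 * c - 1) * (2 * d - 1) = 2 * t - 2 * s"
    using assms(1) by (simp add: s_def t_def algebra_simps)
  moreover have u2: "u\<^sup>2 = (2 * a - 1) * (2 * b - 1)" and v2: "v\<^sup>2 = (2 * c - 1) * (2 * d - 1)"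
    using assms c by (simp_all add: u_def v_def)
  ultimately have uv: "u\<^sup>2 - v\<^sup>2 = 2 * t - 2 * s" by simp
  have vu: "v \<le> u" unfolding u_def v_def
    using u2 v2 uv st by (intro real_sqrt_le_mono) linarith
  have u1: "u \<le> 1" using assms by (simp add: u_def mult_le_one)
  have "0 \<le> (u - v) * (2 - (u + v))" using vu u1 by (intro mult_nonneg_nonneg) auto
  then have "t + v \<le> s + u" using uv by (simp add: algebra_simps power2_eq_square)
  moreover have "(sqrt (2 * c - 1) + sqrt (2 * d - 1))\<^sup>2 = 2 * (t + v) - 2"
    using assms c by (simp add: power2_sum t_def v_def real_sqrt_mult)
  moreover have "(sqrt (2 * a - 1) + sqrt (2 * b - 1))\<^sup>2 = 2 * (s + u) - 2"
    using assms by (simp add: power2_sum s_def u_def real_sqrt_mult)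
  ultimately have "(sqrt (2 * c - 1) + sqrt (2 * d - 1))\<^sup>2 \<le> (sqrt (2 * a - 1) + sqrt (2 * b - 1))\<^sup>2"
    by simp
  then show ?thesis using assms by (rule_tac power2_le_imp_le) auto
qed

text \<open>Convexity of \<^term>\<open>infid\<close>, at two points majorized by \<open>(u, w)\<close>.\<close>

lemma infid_majorize:
  assumes "x + y = u + w" "0 \<le> u" "u \<le> x" "u \<le> y" "x \<le> 1" "y \<le> 1" "w \<le> 1"
  shows "infid x + infid y \<le> infid u + infid w"
proof -
  have d: "2 powr (1 - s) = 2 * 2 powr (- s)" for s :: real
    by (simp add: powr_diff powr_minus divide_simps)
  have half: "s \<le> 1 \<Longrightarrow> 1 / 2 \<le> (2::real) powr (- s)" for s :: real
    using powr_mono[of "-1" "-s" 2] by (simp add: powr_minus)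
  have one: "0 \<le> s \<Longrightarrow> (2::real) powr (- s) \<le> 1" for s :: real
    using powr_mono[of "-s" 0 2] by simp
  \<comment> \<open>Exponentiation turns the equal sums of entropies into equal products. The
    smallest entropy \<open>u\<close> gives the largest factor \<open>c\<close>, and
    \<open>w \<le> 1\<close> gives \<open>d \<ge> 1 / 2\<close>.\<close>
  have "sqrt (2 * 2 powr (- u) - 1) + sqrt (2 * 2 powr (- w) - 1)
      \<le> sqrt (2 * 2 powr (- x) - 1) + sqrt (2 * 2 powr (- y) - 1)"
  proof (rule sqrt_sum_le_of_prod_eq)
    have "- x + - y = - u + - w" using assms by simp
    then show "2 powr (- x) * 2 powr (- y) = 2 powr (- u) * 2 powr (- w :: real)"
      by (simp add: powr_add[symmetric])
  qed (use assms half[of x] half[of y] half[of w] one[of x] one[of y] in auto)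
  moreover have "a + b \<le> c + e \<Longrightarrow> (1 - c) / 2 + (1 - e) / 2 \<le> (1 - a) / 2 + (1 - b) / 2" for a b c e :: real
    by (simp add: field_simps)
  ultimately show ?thesis unfolding infid_def d by blast
qed

lemma f1_infid: "f1 n s = infid (s / n)"
  by (simp add: f1_def infid_def)

text \<open>The extremal distribution of entropy: for \<open>s \<ge> 0\<close>,
  \<open>\<lfloor>s\<rfloor>\<close> qubits of entropy 1, each losing 1/2, and one qubit carrying
  the fractional part.\<close>

lemma f2_infid: "f2 s = infid (frac s) + \<lfloor>s\<rfloor> / 2"
  by (simp add: f2_def infid_def frac_def algebra_simps add_divide_distrib diff_divide_distrib)

lemma f2_add:
  assumes "0 \<le> x" "x \<le> 1"
  shows "f2 s + infid x \<le> f2 (s + x)"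
proof -
  define r where "r = frac s"
  have r: "0 \<le> r" "r < 1" by (auto simp: r_def frac_lt_1)
  \<comment> \<open>Without a carry, \<open>(r, x)\<close> is spread to \<open>(0, r + x)\<close>;
    with a carry, to \<open>(r + x - 1, 1)\<close>, which fills one more qubit.\<close>
  consider "r + x < 1" | "r + x \<ge> 1" by linarith
  then show ?thesis
  proof cases
    case 1
    then have "\<lfloor>s + x\<rfloor> = \<lfloor>s\<rfloor>"
      using assms unfolding r_def frac_def by linarith
    moreover from this have "frac (s + x) = r + x" by (simp add: frac_def r_def)
    ultimately show ?thesis
      using infid_majorize[of r x 0 "r + x"] r assms 1 by (simp add: f2_infid infid_0 r_def)
  next
    case 2
    then have f: "\<lfloor>s + x\<rfloor> = \<lfloor>s\<rfloor> + 1"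
      using assms r unfolding r_def frac_def by linarith
    then have "frac (s + x) = r + x - 1" by (simp add: frac_def r_def)
    then show ?thesis
      using infid_majorize[of r x "r + x - 1" 1] r assms 2 f by (simp add: f2_infid infid_1 r_def add_divide_distrib)
  qed
qed

lemma sum_infid_le_f2:
  assumes "finite A" "\<And>i. i \<in> A \<Longrightarrow> 0 \<le> s i \<and> s i \<le> 1"
  shows "(\<Sum>i\<in>A. infid (s i)) \<le> f2 (\<Sum>i\<in>A. s i)"
  using assms
proof (induction A rule: finite_induct)
  case empty
  show ?case by (simp add: f2_infid infid_0)
next
  case (insert i A)
  then show ?case using f2_add[of "s i" "sum s A"] by (simp add: add.commute)
qed

lemma qproj_le_infid:
  assumes "norm \<psi> = 1" "norm \<phi> = 1"
  shows "infid (renyi2 \<psi> i) \<le> 1 - (norm (qproj i \<phi> \<psi>))\<^sup>2"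
  using qproj_le_purity[OF assms, of i] by (simp add: infid_def purity_renyi2[OF assms(1)] field_simps)

lemma qproj_infid_attained:
  assumes "norm \<psi> = 1"
  shows "\<exists>\<phi>. norm \<phi> = 1 \<and> 1 - (norm (qproj i \<phi> \<psi>))\<^sup>2 = infid (renyi2 \<psi> i)"
proof -
  obtain \<phi> where "norm \<phi> = 1" "(norm (qproj i \<phi> \<psi>))\<^sup>2 = (1 + sqrt (2 * purity \<psi> i - 1)) / 2"
    using qproj_purity_attained[OF assms] by metis
  then show ?thesis
    by (intro exI[of _ \<phi>]) (simp add: infid_def purity_renyi2[OF assms] field_simps)
qed

section \<open>The fidelity bounds\<close>

lemma infidelity_ge_f1:
  fixes u :: "('n::finite) qubits"
  assumes "norm u = 1" "product_state \<psi>"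
  shows "f1 CARD('n) (total_renyi2 u) \<le> 1 - (cmod (braket u \<psi>))\<^sup>2"
proof -
  obtain \<phi> where \<phi>: "\<And>n. norm (\<phi> n) = 1" "\<psi> = (\<chi> x. \<Prod>n\<in>UNIV. \<phi> n $ x n)"
    using assms(2) by (auto simp: product_state_def)
  obtain i where i: "total_renyi2 u / CARD('n) \<le> renyi2 u i"
  proof (rule ccontr)
    assume "\<not> thesis"
    then have "renyi2 u i < total_renyi2 u / CARD('n)" for i using that not_le by blast
    then have "total_renyi2 u < (\<Sum>i\<in>(UNIV::'n set). total_renyi2 u / CARD('n))"
      unfolding total_renyi2_def[of u] by (intro sum_strict_mono) auto
    then show False by simp
  qed
  have "f1 CARD('n) (total_renyi2 u) \<le> infid (renyi2 u i)"
    using i by (simp add: f1_infid infid_mono)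
  also have "\<dots> \<le> 1 - (norm (qproj i (\<phi> i) u))\<^sup>2" by (rule qproj_le_infid[OF assms(1) \<phi>(1)])
  also have "\<dots> \<le> 1 - (cmod (braket u \<psi>))\<^sup>2"
    using overlap_product_le[of \<phi> u i] \<phi> by simp
  finally show ?thesis .
qed

lemma infidelity_le_f2:
  fixes u :: "('n::finite) qubits"
  assumes "norm u = 1"
  shows "\<exists>\<psi>. product_state \<psi> \<and> 1 - (cmod (braket u \<psi>))\<^sup>2 \<le> f2 (total_renyi2 u)"
proof -
  obtain \<phi> where \<phi>: "\<And>i. norm (\<phi> i) = 1" "\<And>i. 1 - (norm (qproj i (\<phi> i) u))\<^sup>2 = infid (renyi2 u i)"
    using qproj_infid_attained[OF assms] by metis
  let ?p = "\<chi> x. \<Prod>n\<in>UNIV. \<phi> n $ x n"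
  have "1 - (cmod (braket u ?p))\<^sup>2 \<le> (\<Sum>i\<in>UNIV. infid (renyi2 u i))"
    using overlap_product_ge[of \<phi> u, OF \<phi>(1) assms] by (simp only: \<phi>(2))
  also have "\<dots> \<le> f2 (total_renyi2 u)"
    unfolding total_renyi2_def using renyi2_bounds[OF assms] by (intro sum_infid_le_f2) auto
  finally show ?thesis using \<phi>(1) by (auto simp: product_state_def)
qed

section \<open>Asymptotics\<close>

text \<open>With x = s ln 2 the radicand is 2 exp(-x) - 1 = (1 - x)^2 + O(x^3), so the root is 1 - x
  + O(x^3) and no quadratic term appears.\<close>

lemma infid_asymp: "(\<lambda>s. infid s - ln 2 / 2 * s) \<in> O[at_right 0](\<lambda>s. s ^ 3)"
  unfolding infid_def by real_asymp

lemma f1_asymp: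
  assumes "n > 0"
  shows "(\<lambda>s. f1 n s - ln 2 / (2 * real n) * s) \<in> O[at_right 0](\<lambda>s. s ^ 3)"
proof -
  have "filterlim (\<lambda>s. s / real n) (at_right 0) (at_right 0)"
    using assms by real_asymp
  from landau_o.big.compose[OF infid_asymp this]
  have "(\<lambda>s. f1 n s - ln 2 / (2 * real n) * s) \<in> O[at_right 0](\<lambda>s. (s / real n) ^ 3)"
    by (simp add: f1_infid)
  also have "(\<lambda>s. (s / real n) ^ 3) \<in> O[at_right 0](\<lambda>s. s ^ 3)"
    using assms by (simp add: power_divide)
  finally show ?thesis .
qed

text \<open>The one-sided filter matters: just left of 0 the floor is -1 and \<open>f2\<close>
  behaves like a square root.\<close>

lemma f2_asymp: "(\<lambda>s. f2 s - ln 2 / 2 * s) \<in> O[at_right 0](\<lambda>s. s ^ 3)"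
proof -
  have "\<forall>\<^sub>F s in at_right 0. f2 s = infid (s::real)"
    using eventually_at_right_real[OF zero_less_one]
  proof eventually_elim
    case (elim s)
    then have "\<lfloor>s\<rfloor> = 0" by (simp add: floor_eq_iff)
    then show ?case by (simp add: f2_infid frac_def)
  qed
  then have "(\<lambda>s. f2 s - ln 2 / 2 * s) \<in> O[at_right 0](\<lambda>s. s ^ 3) \<longleftrightarrow>
      (\<lambda>s. infid s - ln 2 / 2 * s) \<in> O[at_right 0](\<lambda>s. s ^ 3)"
    by (intro landau_o.big.in_cong) (auto elim: eventually_mono)
  then show ?thesis using infid_asymp by simp
qed

theorem theorem3p1:
  shows
   "(\<forall>(v :: ('n::finite) qubits) U \<psi>.
       norm v = 1 \<longrightarrow> unitary U \<longrightarrow> product_state \<psi> \<longrightarrow>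
       1 - (cmod (braket v (U *v \<psi>)))\<^sup>2 \<ge> f1 CARD('n) (total_renyi2 (dagger U *v v)))
    \<and>
    (\<exists>construct :: 'n qubits \<Rightarrow> 'n qubits.
       \<forall>(v :: 'n qubits) U. norm v = 1 \<longrightarrow> unitary U \<longrightarrow>
         product_state (construct (dagger U *v v)) \<and>
         1 - (cmod (braket v (U *v construct (dagger U *v v))))\<^sup>2
           \<le> f2 (total_renyi2 (dagger U *v v)))
    \<and>
    (\<lambda>S. f1 CARD('n) S - ln 2 / (2 * real CARD('n)) * S) \<in> O[at_right 0](\<lambda>S. S ^ 3)
    \<and>
    (\<lambda>S. f2 S - ln 2 / 2 * S) \<in> O[at_right 0](\<lambda>S. S ^ 3)"
proof (intro conjI allI impI)
  fix v \<psi> :: "'n qubits" and U :: "'n qubits ^ ('n \<Rightarrow> 2)"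
  assume "norm v = 1" "unitary U" "product_state \<psi>"
  then show "f1 CARD('n) (total_renyi2 (dagger U *v v)) \<le> 1 - (cmod (braket v (U *v \<psi>)))\<^sup>2"
    using infidelity_ge_f1[of "dagger U *v v" \<psi>] by (simp add: norm_unitary_dagger braket_dagger)
next
  \<comment> \<open>Choice is applied to the state \<open>u\<close> alone, before \<open>v\<close>
    and \<open>U\<close> are fixed, so the product state depends only on
    \<open>dagger U *v v\<close>.\<close>
  obtain construct :: "'n qubits \<Rightarrow> 'n qubits" where "\<And>u. norm u = 1 \<Longrightarrow>
      product_state (construct u) \<and> 1 - (cmod (braket u (construct u)))\<^sup>2 \<le> f2 (total_renyi2 u)"
    using infidelity_le_f2 by metis
  then show "\<exists>construct :: 'n qubits \<Rightarrow> 'n qubits.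
       \<forall>v U. norm v = 1 \<longrightarrow> unitary U \<longrightarrow>
         product_state (construct (dagger U *v v)) \<and>
         1 - (cmod (braket v (U *v construct (dagger U *v v))))\<^sup>2
           \<le> f2 (total_renyi2 (dagger U *v v))"
    by (metis norm_unitary_dagger braket_dagger)
qed (use f1_asymp[of "CARD('n)"] f2_asymp in simp_all)

end
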